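(* Let $\beta$ be a quadratic unitary Pisot number, i.e. $\beta>1$ is the larger root of $x^2=mx+1$ for some integer $m\ge 1$, or of $x^2=mx-1$ for some integer $m\ge 4$. Let $\Lambda$ be a uniformly discrete subset of $\mathbb{Z}[\beta]$ containing $0$ and $1$. Put $r=\left[\frac{m+1}{2}\right]$ if $\beta^2=m\beta+1$ and $r=\left[\frac{m-1}{2}\right]$ if $\beta^2=m\beta-1$ (where $[\cdot]$ is the integer part), and set $$\mathcal{N}=\left\{s\in\mathbb{Z}[\beta] : s'\in\left\{\tfrac1\beta,\tfrac2\beta,\dots,\tfrac{r}{\beta}\right\}\right\},$$ where $'$ denotes the Galois conjugation. Then $\Lambda$ is a model set in $\mathbb{Z}[\beta]$ if and only if $\Lambda$ is $s$-convex for every $s\in\mathcal{N}$.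
   Context: For $\beta$ as in the claim, $\beta'$ is the other root of the same quadratic equation, $\mathbb{Z}[\beta]=\mathbb{Z}+\mathbb{Z}\beta$, and the conjugation is $x=a+b\beta\mapsto x'=a+b\beta'$ ($a,b\in\mathbb{Z}$). For a real parameter $s$, define $x\vdash_s y := sx+(1-s)y$. A set $\Lambda\subset\mathbb{R}$ is $s$-convex if $x\vdash_s y\in\Lambda$ for all $x,y\in\Lambda$. A set $\Lambda\subset\mathbb{R}$ is uniformly discrete if there is $\varepsilon>0$ such that $|x-y|>\varepsilon$ for all distinct $x,y\in\Lambda$. A model set in $\mathbb{Z}[\beta]$ is a set of the form $\Sigma_\beta(\Omega)=\{x\in\mathbb{Z}[\beta] : x'\in\Omega\}$, where $\Omega$ is a bounded interval in $\mathbb{R}$ (with or without either endpoint). *)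

theory Defs
  imports "HOL-Analysis.Analysis"
begin

text \<open>
  \<open>\<beta>\<close> is the larger and \<open>\<beta>'\<close> the other root of \<open>x\<^sup>2 = m x + e\<close>, where the sign \<open>e\<close>
  selects between the two families \<open>x\<^sup>2 = m x + 1\<close> and \<open>x\<^sup>2 = m x - 1\<close>.
\<close>
definition quadratic_unitary_Pisot :: "int \<Rightarrow> int \<Rightarrow> real \<Rightarrow> real \<Rightarrow> bool" where
  "quadratic_unitary_Pisot m e \<beta> \<beta>' \<longleftrightarrow>
     (e = 1 \<and> m \<ge> 1 \<or> e = -1 \<and> m \<ge> 4) \<and>
     \<beta>\<^sup>2 = of_int m * \<beta> + of_int e \<and>
     \<beta>'\<^sup>2 = of_int m * \<beta>' + of_int e \<and>
     \<beta>' < \<beta> \<and> 1 < \<beta>"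

definition Zring :: "real \<Rightarrow> real set" where
  "Zring \<beta> = {of_int a + of_int b * \<beta> | a b :: int. True}"

text \<open>
  Galois conjugation on \<open>\<int>[\<beta>]\<close>. It is well defined because \<open>\<beta>\<close> is irrational (see
  \<open>conjug_eq\<close> below); values outside \<open>\<int>[\<beta>]\<close> are unspecified.
\<close>
definition conjug :: "real \<Rightarrow> real \<Rightarrow> real \<Rightarrow> real" where
  "conjug \<beta> \<beta>' x =
     (THE y. \<exists>a b :: int. x = of_int a + of_int b * \<beta> \<and> y = of_int a + of_int b * \<beta>')"

definition s_convex :: "real \<Rightarrow> real set \<Rightarrow> bool" where
  "s_convex s \<Lambda> \<longleftrightarrow> (\<forall>x\<in>\<Lambda>. \<forall>y\<in>\<Lambda>. s * x + (1 - s) * y \<in> \<Lambda>)"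

definition Sigma_set :: "real \<Rightarrow> real \<Rightarrow> real set \<Rightarrow> real set" where
  "Sigma_set \<beta> \<beta>' \<Omega> = {x \<in> Zring \<beta>. conjug \<beta> \<beta>' x \<in> \<Omega>}"

definition model_set :: "real \<Rightarrow> real \<Rightarrow> real set \<Rightarrow> bool" where
  "model_set \<beta> \<beta>' \<Lambda> \<longleftrightarrow>
     (\<exists>\<Omega>. is_interval \<Omega> \<and> bounded \<Omega> \<and> \<Lambda> = Sigma_set \<beta> \<beta>' \<Omega>)"

definition r_index :: "int \<Rightarrow> int \<Rightarrow> int" where
  "r_index m e = (if e = 1 then \<lfloor>(real_of_int m + 1) / 2\<rfloor> else \<lfloor>(real_of_int m - 1) / 2\<rfloor>)"

definition N_set :: "int \<Rightarrow> int \<Rightarrow> real \<Rightarrow> real \<Rightarrow> real set" where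
  "N_set m e \<beta> \<beta>' =
     {s \<in> Zring \<beta>. conjug \<beta> \<beta>' s \<in> {of_int k / \<beta> | k :: int. 1 \<le> k \<and> k \<le> r_index m e}}"

lemma quadratic_unitary_Pisot_irrational:
  assumes "quadratic_unitary_Pisot m e \<beta> \<beta>'"
  shows "\<beta> \<notin> \<rat>"
proof
  assume "\<beta> \<in> \<rat>"
  then obtain p q :: int where q: "q > 0" "coprime p q" and b: "\<beta> = of_int p / of_int q"
    by (metis Rats_cases' of_rat_of_int_eq)
  from assms have e: "e = 1 \<or> e = -1" and eq: "\<beta>\<^sup>2 = of_int m * \<beta> + of_int e" and gt: "\<beta> > 1"
    by (auto simp: quadratic_unitary_Pisot_def)
  have "(of_int p)\<^sup>2 = (of_int (m * p * q + e * q\<^sup>2) :: real)"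
    using eq q unfolding b by (simp add: field_simps power2_eq_square)
  then have p2: "p\<^sup>2 = m * p * q + e * q\<^sup>2"
    by (metis of_int_eq_iff of_int_power)
  then have "p\<^sup>2 = q * (m * p + e * q)"
    by (simp add: algebra_simps power2_eq_square)
  then have "q dvd p\<^sup>2" by simp
  moreover have "coprime q (p\<^sup>2)" using q by (simp add: coprime_commute)
  ultimately have "is_unit q" using coprime_absorb_left by blast
  with q have "q = 1" by simp
  with p2 have "p * (p - m) = e" by (simp add: algebra_simps power2_eq_square)
  then have "p dvd e" by (metis dvd_triv_left)
  with e have "p dvd 1" by auto
  moreover have "p > 1" using gt b \<open>q = 1\<close> by simp
  ultimately show False by simp
qed

lemma conjug_eq:
  assumes "quadratic_unitary_Pisot m e \<beta> \<beta>'"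
  shows "conjug \<beta> \<beta>' (of_int a + of_int b * \<beta>) = of_int a + of_int b * \<beta>'"
proof -
  have uniq: "a = c \<and> b = d" if h: "of_int a + of_int b * \<beta> = of_int c + of_int d * \<beta>" for c d :: int
  proof -
    have "b = d"
    proof (rule ccontr)
      assume "b \<noteq> d"
      then have "\<beta> = of_int (c - a) / of_int (b - d)"
        using h by (simp add: field_simps)
      then have "\<beta> \<in> \<rat>" by (metis Rats_divide Rats_of_int)
      with quadratic_unitary_Pisot_irrational[OF assms] show False by simp
    qed
    with h show ?thesis by simp
  qed
  show ?thesis
    unfolding conjug_def by (rule the_equality) (use uniq in blast)+
qed

end

theory Submission
  imports Defs
begin

text \<open>
  Conjugation turns \<open>s\<close>-convexity for \<open>s \<in> N\<close> into \<open>k g\<close>-convexity, \<open>1 \<le> k \<le> r\<close>, where \<open>g = 1 / \<beta>\<close>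
  is a unit. Write \<open>D\<close> for the image of \<open>\<Lambda>\<close>. The points generated from \<open>0\<close> and \<open>1\<close> fill
  \<open>\<int>[g] \<inter> [0, 1]\<close>: this interval is covered by images of itself under homotheties whose ratio is a
  unit and whose centres are already generated, and inverting such a homothety decreases the
  absolute value of \<open>b\<close> in \<open>a + b g\<close>. Hence \<open>D\<close> is stable under homotheties of ratio \<open>g\<^sup>n\<close> centred
  at its points, and a supremum argument shows that \<open>D\<close> contains all of \<open>\<int>[g]\<close> between any two of
  its points. If \<open>D\<close> were unbounded, it would contain \<open>\<beta>\<^sup>n\<close> for all \<open>n\<close>, or \<open>- \<beta>\<^sup>n\<close> for all \<open>n\<close>; the
  conjugates of these numbers tend to \<open>0 \<in> \<Lambda>\<close>, against uniform discreteness.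
\<close>

section \<open>The set generated by 0 and 1\<close>

inductive_set convex_gen :: "real \<Rightarrow> int \<Rightarrow> real set" for g :: real and r :: int where
  zero: "0 \<in> convex_gen g r"
| one: "1 \<in> convex_gen g r"
| step: "\<lbrakk>x \<in> convex_gen g r; y \<in> convex_gen g r; 1 \<le> k; k \<le> r\<rbrakk>
    \<Longrightarrow> of_int k * g * x + (1 - of_int k * g) * y \<in> convex_gen g r"

text \<open>The affine map taking 0 to \<open>p\<close> and 1 to \<open>q\<close> commutes with the
  combinations that generate \<open>convex_gen g r\<close>, so rule induction carries the whole
  generated set into \<open>D\<close>.\<close>

lemma convex_gen_affine:
  assumes "t \<in> convex_gen g r" "p \<in> D" "q \<in> D"
    and "\<And>k::int. \<lbrakk>1 \<le> k; k \<le> r\<rbrakk> \<Longrightarrow> s_convex (of_int k * g) D"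
  shows "p + t * (q - p) \<in> D"
  using assms(1)
proof induction
  case (step x y k)
  have "of_int k * g * (p + x * (q - p)) + (1 - of_int k * g) * (p + y * (q - p)) \<in> D"
    using assms(4)[OF step.hyps(3,4)] step.IH unfolding s_convex_def by blast
  moreover have "of_int k * g * (p + x * (q - p)) + (1 - of_int k * g) * (p + y * (q - p))
      = p + (of_int k * g * x + (1 - of_int k * g) * y) * (q - p)"
    by (simp add: algebra_simps)
  ultimately show ?case by simp
qed (use assms in auto)

text \<open>The generated set is itself closed under its generating combinations, so it may play the
  role of \<open>D\<close> in \<open>convex_gen_affine\<close>.\<close>

lemma convex_gen_homothety:
  assumes "p \<in> convex_gen g r" "q \<in> convex_gen g r" "t \<in> convex_gen g r"
  shows "p + t * (q - p) \<in> convex_gen g r"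
  using convex_gen_affine[OF assms(3,1,2)] by (simp add: s_convex_def convex_gen.step)

lemma convex_gen_compl: "t \<in> convex_gen g r \<Longrightarrow> 1 - t \<in> convex_gen g r"
  using convex_gen_homothety[OF convex_gen.one convex_gen.zero] by fastforce

lemma convex_gen_multiple:
  assumes "0 \<le> k" "k \<le> r"
  shows "of_int k * g \<in> convex_gen g r"
proof (cases "k = 0")
  case False
  then show ?thesis
    using convex_gen.step[OF convex_gen.one convex_gen.zero, of k r g] assms by simp
qed (simp add: convex_gen.zero)

lemma convex_gen_descent:
  assumes "p \<in> convex_gen g r" "q \<in> convex_gen g r" "(x - p) / (q - p) \<in> convex_gen g r" "p \<noteq> q"
  shows "x \<in> convex_gen g r"
  using convex_gen_homothety[OF assms(1,2,3)] assms(4) by simp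

lemma r_index_eq: "r_index m e = (if e = 1 then (m + 1) div 2 else (m - 1) div 2)"
  using floor_divide_of_int_eq[of "m + 1" 2, where ?'a = real]
    floor_divide_of_int_eq[of "m - 1" 2, where ?'a = real]
  by (simp add: r_index_def)

section \<open>Arithmetic in \<open>Zring x\<close>\<close>

lemma Zring_iff: "u \<in> Zring x \<longleftrightarrow> (\<exists>a b :: int. u = of_int a + of_int b * x)"
  by (simp add: Zring_def)

lemma Zring_of_int: "of_int a \<in> Zring x"
  unfolding Zring_iff by (rule exI[of _ a], rule exI[of _ 0]) simp

lemma Zring_one: "1 \<in> Zring x"
  using Zring_of_int[of 1] by simp

lemma Zring_self: "x \<in> Zring x"
  unfolding Zring_iff by (rule exI[of _ 0], rule exI[of _ 1]) simp

lemma Zring_add: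
  assumes "u \<in> Zring x" "v \<in> Zring x"
  shows "u + v \<in> Zring x"
proof -
  obtain a b c d :: int where "u = of_int a + of_int b * x" "v = of_int c + of_int d * x"
    using assms unfolding Zring_iff by blast
  then have "u + v = of_int (a + c) + of_int (b + d) * x" by (simp add: algebra_simps)
  then show ?thesis unfolding Zring_iff by blast
qed

lemma Zring_uminus:
  assumes "u \<in> Zring x"
  shows "- u \<in> Zring x"
proof -
  obtain a b :: int where "u = of_int a + of_int b * x" using assms unfolding Zring_iff by blast
  then have "- u = of_int (- a) + of_int (- b) * x" by simp
  then show ?thesis unfolding Zring_iff by blast
qed

lemma Zring_diff: "u \<in> Zring x \<Longrightarrow> v \<in> Zring x \<Longrightarrow> u - v \<in> Zring x"
  using Zring_add[OF _ Zring_uminus, of u x v] by simp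

text \<open>The resulting coefficients depend on \<open>p\<close> and \<open>q\<close> but not on
  \<open>x\<close>, so they agree for both roots of the quadratic; this makes conjugation
  multiplicative.\<close>

lemma Zring_product:
  fixes x :: real and p q a b c d :: int
  assumes "x\<^sup>2 = of_int p * x + of_int q"
  shows "(of_int a + of_int b * x) * (of_int c + of_int d * x) =
    of_int (a * c + b * d * q) + of_int (a * d + b * c + b * d * p) * x"
proof -
  have "(of_int a + of_int b * x) * (of_int c + of_int d * x) =
    of_int (a * c) + of_int (a * d + b * c) * x + of_int (b * d) * x\<^sup>2"
    by (simp add: algebra_simps power2_eq_square)
  then show ?thesis unfolding assms by (simp add: algebra_simps)
qed

lemma Zring_mult:
  fixes x :: real and p q :: int
  assumes "x\<^sup>2 = of_int p * x + of_int q" "u \<in> Zring x" "v \<in> Zring x"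
  shows "u * v \<in> Zring x"
  using assms(2,3) Zring_product[OF assms(1)] unfolding Zring_def by blast

section \<open>The unit \<open>g\<close> and the descent in the unit interval\<close>

locale pisot_inverse =
  fixes g :: real and m e :: int
  assumes me: "e = 1 \<and> m \<ge> 1 \<or> e = -1 \<and> m \<ge> 4"
    and g_pos: "0 < g" and g_less_1: "g < 1"
    and g_square: "g\<^sup>2 = of_int e * (1 - of_int m * g)"
begin

abbreviation "r \<equiv> r_index m e"
abbreviation "G \<equiv> convex_gen g r"

lemma r_pos: "1 \<le> r"
  using me by (auto simp: r_index_eq)

lemma e_square: "of_int e * of_int e = (1::real)"
  using me by auto

lemma inverse_g: "1 / g = of_int m + of_int e * g"
proof -
  have "g * (of_int m + of_int e * g) = of_int m * g + of_int e * g\<^sup>2"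
    by (simp add: algebra_simps power2_eq_square)
  also have "\<dots> = of_int m * g + (of_int e * of_int e) * (1 - of_int m * g)"
    by (simp add: g_square mult.assoc)
  finally show ?thesis using g_pos by (simp add: e_square field_simps)
qed

text \<open>Up to sign, the constant term becomes the new coefficient of \<open>g\<close>. This
  drives the descent: an element of the unit interval with \<open>b > 0\<close> satisfies
  \<open>\<bar>a\<bar> < b\<close>.\<close>

lemma divide_g: "(of_int a + of_int b * g) / g = of_int (a * m + b) + of_int (e * a) * g"
proof -
  have "(of_int a + of_int b * g) / g = of_int a * (1 / g) + of_int b"
    using g_pos by (simp add: field_simps)
  then show ?thesis by (simp add: inverse_g algebra_simps)
qed

text \<open>
  For \<open>e = -1\<close> the multiples of \<open>g\<close> between \<open>r g\<close> and \<open>1\<close> come from \<open>(m - k) g = 1 - k g + g\<^sup>2\<close>.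
  If \<open>m = 2 n\<close>, only \<open>n g\<close> is missed; it is \<open>p + g (q - p)\<close> with \<open>p = n g - n g\<^sup>2\<close> and
  \<open>q = 1 - (n - 1) g\<^sup>2\<close>.
\<close>
lemma convex_gen_digit:
  assumes e: "e = -1" and k: "0 \<le> k" "k \<le> m - 1"
  shows "of_int k * g \<in> G"
proof -
  have m4: "m \<ge> 4" using me e by auto
  have r: "r = (m - 1) div 2" using e by (simp add: r_index_eq)
  have sq: "g * g = of_int m * g - 1" using g_square e by (simp add: power2_eq_square)
  have gG: "g \<in> G" using convex_gen_multiple[of 1 r g] r_pos by simp
  consider "k \<le> r" | "m - r \<le> k" | "r < k" "k < m - r" by linarith
  then show ?thesis
  proof cases
    case 1
    then show ?thesis using convex_gen_multiple k by simp
  next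
    case 2
    have a: "1 - of_int (m - k) * g \<in> G"
      by (rule convex_gen_compl, rule convex_gen_multiple) (use 2 k in auto)
    have b: "1 - of_int (m - k - 1) * g \<in> G"
      by (rule convex_gen_compl, rule convex_gen_multiple) (use 2 k in auto)
    have "1 - of_int (m - k) * g + g * ((1 - of_int (m - k - 1) * g) - (1 - of_int (m - k) * g))
       = 1 - of_int (m - k) * g + g * g"
      by (simp add: algebra_simps)
    also have "\<dots> = of_int k * g" unfolding sq by (simp add: algebra_simps)
    finally show ?thesis using convex_gen_homothety[OF a b gG] by simp
  next
    case 3
    define n where "n = k"
    have mn: "m = 2 * n" and rn: "r = n - 1" using 3 r unfolding n_def by presburger+
    have n1: "of_int (n - 1) * g \<in> G"
      by (rule convex_gen_multiple) (use rn r_pos in auto)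
    have c: "1 - g \<in> G" by (rule convex_gen_compl[OF gG])
    have "1 + (of_int (n - 1) * g) * ((1 - g) - 1) \<in> G"
      by (rule convex_gen_homothety[OF convex_gen.one c n1])
    then have q: "1 - of_int (n - 1) * (g * g) \<in> G" by (simp add: algebra_simps)
    have "of_int (n - 1) * g + g * ((1 - g) - of_int (n - 1) * g) \<in> G"
      by (rule convex_gen_homothety[OF n1 c gG])
    then have p: "of_int n * g - of_int n * (g * g) \<in> G" by (simp add: algebra_simps)
    \<comment> \<open>The factor left over, \<open>1 - 2 n g + g\<^sup>2\<close>, vanishes by the
      quadratic equation of \<open>g\<close> with \<open>m = 2 n\<close>.\<close>
    have "of_int n * g - of_int n * (g * g) + g * (1 - of_int (n - 1) * (g * g)
        - (of_int n * g - of_int n * (g * g)))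
      = of_int n * g + g * (1 - 2 * of_int n * g + g * g)"
      by (simp add: algebra_simps)
    also have "\<dots> = of_int k * g" unfolding sq mn n_def by simp
    finally show ?thesis using convex_gen_homothety[OF p q gG] by simp
  qed
qed

text \<open>
  Homotheties of ratio \<open>g\<close> (or \<open>g\<^sup>2\<close>) whose images cover the unit interval reduce \<open>a + b g\<close> to an
  element whose coefficient of \<open>g\<close> is smaller in absolute value.
\<close>
lemma convex_gen_reduce:
  assumes IH: "\<And>a' b' :: int. \<lbrakk>\<bar>b'\<bar> < b; 0 \<le> of_int a' + of_int b' * g;
      of_int a' + of_int b' * g \<le> 1\<rbrakk> \<Longrightarrow> of_int a' + of_int b' * g \<in> G"
    and b: "0 < b" and x: "x = of_int a + of_int b * g" and x0: "0 \<le> x" and x1: "x \<le> 1"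
  shows "x \<in> G"
proof -
  have bg: "0 < of_int b * g" "of_int b * g < of_int b"
    using b g_pos g_less_1 by auto
  have a0: "a \<le> 0" using x x1 bg by linarith
  have ab: "- a < b" using x x0 bg by linarith
  have eabs: "\<bar>e * c\<bar> = \<bar>c\<bar>" for c using me by auto
  \<comment> \<open>On a cell starting at \<open>k g\<close>, inverting the homothety gives the
    coefficient \<open>e a\<close>, and \<open>\<bar>a\<bar> < b\<close>.\<close>
  have lower: "x \<in> G" if "p = of_int k * g" "p \<in> G" "p + g \<in> G" "p \<le> x" "x \<le> p + g" for p k
  proof (rule convex_gen_descent[OF that(2,3)])
    have "(x - p) / (p + g - p) = of_int (a * m + b - k) + of_int (e * a) * g"
      using divide_g[of a b] g_pos unfolding that(1) x by (simp add: field_simps)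
    moreover have "0 \<le> (x - p) / (p + g - p)" "(x - p) / (p + g - p) \<le> 1"
      using that(4,5) g_pos by auto
    ultimately show "(x - p) / (p + g - p) \<in> G"
      using IH[of "e * a" "a * m + b - k"] a0 ab by (simp add: eabs)
  qed (use g_pos in auto)
  \<comment> \<open>On a cell starting at \<open>1 - k g\<close> the new coefficient is
    \<open>e (a - 1)\<close>, so \<open>1 - a < b\<close> is required. From \<open>g \<le> x\<close>
    one gets \<open>- a \<le> (b - 1) g < b - 1\<close> when \<open>b > 1\<close>; for
    \<open>b = 1\<close> the element is \<open>g\<close> itself.\<close>
  have upper: "x \<in> G"
    if "p = 1 - of_int k * g" "p \<in> G" "p + g \<in> G" "p \<le> x" "x \<le> p + g" and xg: "g \<le> x" for p k
  proof (cases "b = 1")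
    case True
    then have "a = 0" using a0 ab by simp
    then show ?thesis using convex_gen_multiple[of 1 r g] r_pos x True by simp
  next
    case False
    have "- of_int a \<le> of_int (b - 1) * g"
      using xg x by (simp add: algebra_simps)
    also have "\<dots> < of_int (b - 1)" using g_less_1 False b by simp
    finally have small: "\<bar>a - 1\<bar> < b" using a0 by linarith
    have "(x - p) / (p + g - p) = (of_int (a - 1) + of_int b * g) / g + of_int k"
      using g_pos unfolding that(1) x by (simp add: field_simps)
    then have "(x - p) / (p + g - p) = of_int ((a - 1) * m + b + k) + of_int (e * (a - 1)) * g"
      unfolding divide_g by simp
    moreover have "0 \<le> (x - p) / (p + g - p)" "(x - p) / (p + g - p) \<le> 1"
      using that(4,5) g_pos by auto
    ultimately have "(x - p) / (p + g - p) \<in> G"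
      using IH[of "e * (a - 1)" "(a - 1) * m + b + k"] small by (simp only: eabs)
    then show ?thesis by (rule convex_gen_descent[OF that(2,3)]) (use g_pos in auto)
  qed
  have floor: "of_int \<lfloor>x / g\<rfloor> * g \<le> x" "x \<le> of_int \<lfloor>x / g\<rfloor> * g + g" "0 \<le> \<lfloor>x / g\<rfloor>"
  proof -
    have "of_int \<lfloor>x / g\<rfloor> \<le> x / g" "x / g \<le> of_int \<lfloor>x / g\<rfloor> + 1" by linarith+
    then show "of_int \<lfloor>x / g\<rfloor> * g \<le> x" "x \<le> of_int \<lfloor>x / g\<rfloor> * g + g"
      using g_pos by (simp_all only: pos_le_divide_eq pos_divide_le_eq distrib_right mult_1)
    show "0 \<le> \<lfloor>x / g\<rfloor>" using x0 g_pos by simp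
  qed
  have multiples: "x \<in> G" if "x < of_int K * g" "\<And>k::int. \<lbrakk>0 \<le> k; k \<le> K\<rbrakk> \<Longrightarrow> of_int k * g \<in> G" for K
  proof (rule lower[OF refl _ _ floor(1,2)])
    have "x / g < of_int K" using that(1) g_pos by (simp add: field_simps)
    then have "\<lfloor>x / g\<rfloor> + 1 \<le> K" by linarith
    then show "of_int \<lfloor>x / g\<rfloor> * g \<in> G" "of_int \<lfloor>x / g\<rfloor> * g + g \<in> G"
      using that(2)[of "\<lfloor>x / g\<rfloor>"] that(2)[of "\<lfloor>x / g\<rfloor> + 1"] floor(3)
      by (simp_all add: algebra_simps)
  qed
  from me consider "e = -1" "m \<ge> 4" | "e = 1" "m \<ge> 1" by auto
  then show ?thesis
  proof cases
    case 1
    have sq: "g * g = of_int m * g - 1" using g_square 1 by (simp add: power2_eq_square)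
    show ?thesis
    proof (cases "x < of_int (m - 1) * g")
      case True
      then show ?thesis using multiples convex_gen_digit[OF 1(1)] by blast
    next
      case False
      \<comment> \<open>Since \<open>m g = 1 + g\<^sup>2\<close> exceeds 1, the multiples up to
        \<open>(m - 1) g\<close> leave at most the last cell, from \<open>1 - g\<close> to
        1.\<close>
      have "1 * g \<le> of_int (m - 1) * g"
        by (rule mult_right_mono) (use 1 g_pos in auto)
      moreover have "1 - g \<le> of_int (m - 1) * g"
        using sq zero_le_square[of g] unfolding of_int_diff left_diff_distrib by simp
      moreover have "1 - g \<in> G"
        using convex_gen_compl convex_gen_multiple[of 1 r g] r_pos by simp
      ultimately show ?thesis
        using upper[of "1 - g" 1] False x1 convex_gen.one by simp
    qed
  next
    case 2
    have r: "r = (m + 1) div 2" using 2 by (simp add: r_index_eq)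
    have sq: "g * g = 1 - of_int m * g" using g_square 2 by (simp add: power2_eq_square)
    have rg: "g \<le> of_int r * g" using r_pos g_pos by simp
    \<comment> \<open>Multiples of \<open>g\<close> cover the part up to \<open>r g\<close>, and
      their mirror images cover the part from \<open>1 - r g\<close>. A gap between them occurs only
      for \<open>m = 2 r\<close>; its length is then \<open>1 - m g = g\<^sup>2\<close>, which calls
      for a homothety of ratio \<open>g\<^sup>2\<close>.\<close>
    consider "x < of_int r * g" | "of_int r * g \<le> x" "1 - of_int r * g \<le> x" |
      "of_int r * g \<le> x" "x \<le> 1 - of_int r * g" "\<not> 1 - of_int r * g \<le> of_int r * g"
      by linarith
    then show ?thesis
    proof cases
      case 1
      then show ?thesis using multiples convex_gen_multiple by blast
    next
      case 2
      show ?thesis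
      proof (cases "x = 1")
        case False
        \<comment> \<open>Cells are counted from the right end. Excluding \<open>x = 1\<close>
          ensures \<open>k \<ge> 1\<close>, so that the right end \<open>1 - (k - 1) g\<close> of
          the cell is a generated point.\<close>
        define k where "k = \<lceil>(1 - x) / g\<rceil>"
        have "(1 - x) / g \<le> of_int r" using 2 g_pos by (simp add: field_simps)
        then have kr: "k \<le> r" unfolding k_def by (simp add: ceiling_le)
        have "0 < (1 - x) / g" using False x1 g_pos by simp
        then have k1: "1 \<le> k" unfolding k_def by linarith
        have "(1 - x) / g \<le> of_int k" "of_int k - 1 \<le> (1 - x) / g" unfolding k_def by linarith+
        then have "1 - of_int k * g \<le> x" "x \<le> 1 - of_int k * g + g"
          using g_pos by (simp_all add: field_simps)
        moreover have "1 - of_int k * g \<in> G"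
          using convex_gen_compl convex_gen_multiple k1 kr by simp
        moreover have "1 - of_int (k - 1) * g \<in> G"
          by (rule convex_gen_compl, rule convex_gen_multiple) (use k1 kr in auto)
        then have "1 - of_int k * g + g \<in> G" by (simp add: algebra_simps)
        moreover have "g \<le> x" using rg 2 by linarith
        ultimately show ?thesis using upper[OF refl] by blast
      qed (simp add: convex_gen.one)
    next
      case 3
      have "\<not> (m < 2 * r)"
      proof
        assume "m < 2 * r"
        then have "m + 1 = 2 * r" using r by linarith
        then have "of_int m = 2 * of_int r - (1::real)"
          by (metis add_diff_cancel of_int_1 of_int_diff of_int_mult of_int_numeral)
        then have "g * g = 1 - 2 * of_int r * g + g"
          using sq by (simp only: left_diff_distrib mult_1)
        moreover have "g * g < g" using g_pos g_less_1 by simp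
        ultimately show False using 3(3) by linarith
      qed
      then have m: "m = 2 * r" using r by linarith
      have "of_int m = (2 * of_int r :: real)" by (subst m) simp
      then have q: "1 - of_int r * g = of_int r * g + g * g"
        using sq by simp
      let ?p = "of_int r * g" and ?A = "a * m + b - r"
      have pG: "?p \<in> G" "1 - ?p \<in> G"
        using convex_gen_multiple[of r r g] convex_gen_compl r_pos by auto
      have A: "(x - ?p) / g = of_int ?A + of_int a * g"
        using divide_g[of a b] g_pos 2(1) unfolding x by (simp add: field_simps)
      have A01: "0 \<le> (x - ?p) / g" "(x - ?p) / g \<le> g"
        using 3 q g_pos by (simp_all add: field_simps)
      have t: "(x - ?p) / ((1 - ?p) - ?p) = of_int (?A * m + a) + of_int ?A * g"
      proof -
        have "(x - ?p) / ((1 - ?p) - ?p) = ((x - ?p) / g) / g" unfolding q by simp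
        then show ?thesis unfolding A divide_g using 2 by simp
      qed
      \<comment> \<open>After two divisions by \<open>g\<close> the new coefficient is
        \<open>?A = (x - ?p) / g - a g\<close>. As the quotient lies between 0 and \<open>g\<close>,
        and \<open>- b < a \<le> 0\<close>, this gives
        \<open>0 \<le> ?A \<le> (1 - a) g \<le> b g < b\<close>.\<close>
      have "of_int ?A \<le> of_int (1 - a) * g" using A A01 by (simp add: algebra_simps)
      also have "\<dots> \<le> of_int b * g"
        by (rule mult_right_mono) (use ab g_pos in auto)
      finally have "of_int ?A < (of_int b :: real)" using bg by linarith
      moreover have "of_int a * g \<le> 0" using a0 g_pos by (simp add: mult_nonpos_nonneg)
      then have "0 \<le> (of_int ?A :: real)" using A A01 by linarith
      ultimately have small: "\<bar>?A\<bar> < b" by linarith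
      have pq: "0 < (1 - ?p) - ?p" using 3 by linarith
      then have "0 \<le> (x - ?p) / ((1 - ?p) - ?p)" "(x - ?p) / ((1 - ?p) - ?p) \<le> 1"
        using 3 by (simp_all only: pos_le_divide_eq pos_divide_le_eq mult_1 mult_zero_left)
      then have "(x - ?p) / ((1 - ?p) - ?p) \<in> G"
        using IH[OF small, of "?A * m + a"] unfolding t by blast
      then show ?thesis by (rule convex_gen_descent[OF pG]) (use pq in linarith)
    qed
  qed
qed

text \<open>Strong induction on \<open>\<bar>b\<bar>\<close>: only 0 and 1 have
  \<open>b = 0\<close>, and the reflection \<open>t \<mapsto> 1 - t\<close> negates
  \<open>b\<close>, which reduces negative coefficients to positive ones.\<close>

lemma convex_gen_unit_interval:
  assumes "x \<in> Zring g" "0 \<le> x" "x \<le> 1"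
  shows "x \<in> G"
proof -
  have "of_int a + of_int b * g \<in> G"
    if "0 \<le> of_int a + of_int b * g" "of_int a + of_int b * g \<le> 1" for a b :: int
    using that
  proof (induction "nat \<bar>b\<bar>" arbitrary: a b rule: less_induct)
    case less
    have IH: "of_int a' + of_int b' * g \<in> G"
      if "\<bar>b'\<bar> < \<bar>b\<bar>" "0 \<le> of_int a' + of_int b' * g" "of_int a' + of_int b' * g \<le> 1" for a' b'
      using less.hyps[of b' a'] that by simp
    consider "b = 0" | "b > 0" | "b < 0" by linarith
    then show ?case
    proof cases
      case 1
      then have "a = 0 \<or> a = 1" using less.prems by auto
      then show ?thesis using 1 convex_gen.zero convex_gen.one by auto
    next
      case 2
      show ?thesis by (rule convex_gen_reduce[OF _ 2 refl]) (use IH 2 less.prems in auto)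
    next
      case 3
      have "of_int (1 - a) + of_int (- b) * g \<in> G"
        by (rule convex_gen_reduce[of "- b", OF _ _ refl]) (use IH 3 less.prems in auto)
      from convex_gen_compl[OF this] show ?thesis by (simp add: algebra_simps)
    qed
  qed
  then show ?thesis using assms unfolding Zring_def by blast
qed

end

section \<open>Order convexity\<close>

text \<open>\<open>D\<close> stands for the conjugate image of \<open>\<Lambda>\<close>. It is kept
  as a parameter so that the results also apply to its reflection \<open>1 - D\<close>.\<close>

locale convex_subset = pisot_inverse +
  fixes D :: "real set"
  assumes sub_Zring: "D \<subseteq> Zring g" and zero_D: "0 \<in> D" and one_D: "1 \<in> D"
    and convex_D: "\<And>k::int. \<lbrakk>1 \<le> k; k \<le> r\<rbrakk> \<Longrightarrow> s_convex (of_int k * g) D"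
begin

lemma Zring_g_mult: "u \<in> Zring g \<Longrightarrow> v \<in> Zring g \<Longrightarrow> u * v \<in> Zring g"
  by (rule Zring_mult[of g "- e * m" e]) (simp_all add: g_square algebra_simps)

lemma Zring_g_power: "g ^ n \<in> Zring g"
proof (induction n)
  case (Suc n)
  then show ?case using Zring_g_mult[OF Zring_self] by simp
qed (simp add: Zring_one)

lemma Zring_g_divide: "u \<in> Zring g \<Longrightarrow> u / g ^ n \<in> Zring g"
proof (induction n)
  case (Suc n)
  then obtain a b :: int where "u / g ^ n = of_int a + of_int b * g" unfolding Zring_iff by blast
  moreover have "u / g ^ Suc n = u / g ^ n / g" by simp
  ultimately have "u / g ^ Suc n = of_int (a * m + b) + of_int (e * a) * g"
    by (simp only: divide_g)
  then show ?case unfolding Zring_iff by blast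
qed simp

text \<open>The generated set fills the unit interval of the ring, so the admissible ratios extend
  from the multiples \<open>k g\<close> to all ring elements between 0 and 1.\<close>

lemma segment:
  assumes "p \<in> D" "q \<in> D" "t \<in> Zring g" "0 \<le> t" "t \<le> 1"
  shows "p + t * (q - p) \<in> D"
  using convex_gen_affine[OF convex_gen_unit_interval[OF assms(3-5)] assms(1,2) convex_D] .

lemma g_power_le_1: "g ^ n \<le> 1"
  using g_pos g_less_1 by (simp add: power_le_one)

lemma unit_interval: "\<lbrakk>x \<in> Zring g; 0 \<le> x; x \<le> 1\<rbrakk> \<Longrightarrow> x \<in> D"
  using segment[OF zero_D one_D] by simp

text \<open>
  The homotheties of ratio \<open>g\<^sup>n\<close> centred at \<open>y\<close> map \<open>[0, b]\<close> to intervals that cover \<open>[0, y)\<close>, and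
  they are bijections of \<open>\<int>[g]\<close> because \<open>g\<close> is a unit.
\<close>
lemma extend:
  assumes full: "\<And>z. \<lbrakk>z \<in> Zring g; 0 \<le> z; z \<le> b\<rbrakk> \<Longrightarrow> z \<in> D"
    and y: "y \<in> D" "0 < y" "y - b \<le> y * g"
    and z: "z \<in> Zring g" "0 \<le> z" "z \<le> y"
  shows "z \<in> D"
proof (cases "z = y")
  case False
  then have yz: "0 < (y - z) / y" using z y by simp
  \<comment> \<open>This scale satisfies \<open>g ^ Suc n < (y - z) / y \<le> g ^ n\<close>.
    Expanding \<open>z\<close> away from \<open>y\<close> by the factor \<open>1 / g ^ n\<close>
    therefore lands between 0 and \<open>y - y g\<close>, which is at most \<open>b\<close>.\<close>
  define n where "n = (LEAST n. g ^ Suc n < (y - z) / y)"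
  obtain k where k: "g ^ k < (y - z) / y" using real_arch_pow_inv[OF yz g_less_1] by blast
  have "g ^ Suc k \<le> g ^ k" using g_pos g_less_1 by (simp add: mult_left_le_one_le)
  then have "g ^ Suc k < (y - z) / y" using k by linarith
  then have n: "g ^ Suc n < (y - z) / y" unfolding n_def by (rule LeastI)
  have n': "(y - z) / y \<le> g ^ n"
  proof (cases n)
    case 0
    then show ?thesis using y z by simp
  next
    case (Suc l)
    then have "\<not> g ^ Suc l < (y - z) / y" using not_less_Least[of l "\<lambda>n. g ^ Suc n < (y - z) / y"]
      unfolding n_def by simp
    then show ?thesis using Suc by simp
  qed
  have gn: "0 < g ^ n" using g_pos by simp
  define u where "u = y - (y - z) / g ^ n"
  have "u \<in> Zring g"
    unfolding u_def using y(1) sub_Zring z(1) by (auto intro!: Zring_diff Zring_g_divide)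
  moreover have "0 \<le> u" unfolding u_def using n' gn y(2) by (simp add: field_simps)
  moreover have "u \<le> b"
  proof -
    have "y * g * g ^ n < y - z" using n y(2) by (simp add: field_simps)
    then have "y * g < (y - z) / g ^ n" using gn by (simp add: field_simps)
    then show ?thesis unfolding u_def using y(3) by linarith
  qed
  ultimately have "u \<in> D" by (rule full)
  then have "y + g ^ n * (u - y) \<in> D"
    by (rule segment[OF y(1) _ Zring_g_power]) (use gn g_power_le_1 in auto)
  moreover have "g ^ n * (u - y) = z - y" unfolding u_def using g_pos by simp
  ultimately show ?thesis by simp
qed (use y in simp)

lemma Zring_g_dense:
  assumes "0 < c" "0 < \<delta>"
  shows "\<exists>p \<in> Zring g. 0 \<le> p \<and> p < c \<and> c - p < \<delta>"
proof -
  obtain n where n: "g ^ n < \<delta>" using real_arch_pow_inv[OF assms(2) g_less_1] by blast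
  have gn: "0 < g ^ n" using g_pos by simp
  \<comment> \<open>The ceiling minus one, unlike the floor, keeps \<open>k g ^ n\<close> strictly
    below \<open>c\<close>.\<close>
  define k where "k = \<lceil>c / g ^ n\<rceil> - 1"
  have "of_int k < c / g ^ n" "c / g ^ n \<le> of_int k + 1" unfolding k_def by linarith+
  then have "of_int k * g ^ n < c" "c \<le> of_int k * g ^ n + g ^ n"
    using gn by (simp_all add: pos_less_divide_eq pos_divide_le_eq distrib_right)
  moreover have "0 < c / g ^ n" using assms gn by simp
  then have "0 \<le> k" unfolding k_def by linarith
  then have "0 \<le> of_int k * g ^ n" using gn by simp
  moreover have "of_int k * g ^ n \<in> Zring g"
    by (rule Zring_g_mult[OF Zring_of_int Zring_g_power])
  ultimately show ?thesis using n by (intro bexI[of _ "of_int k * g ^ n"]) auto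
qed

lemma fill_below:
  assumes y: "y \<in> D" and z: "z \<in> Zring g" "0 \<le> z" "z \<le> y"
  shows "z \<in> D"
proof (cases "y \<le> 1")
  case True
  then show ?thesis using unit_interval z by simp
next
  case False
  define S where "S = {t. t \<le> y \<and> (\<forall>z \<in> Zring g. 0 \<le> z \<longrightarrow> z \<le> t \<longrightarrow> z \<in> D)}"
  define c where "c = Sup S"
  have S1: "1 \<in> S" unfolding S_def using False unit_interval by simp
  have bdd: "bdd_above S" unfolding S_def by (rule bdd_aboveI[of _ y]) simp
  have c1: "1 \<le> c" unfolding c_def using cSup_upper[OF S1 bdd] .
  have cy: "c \<le> y" unfolding c_def by (rule cSup_least) (use S1 S_def in auto)
  have full: "x \<in> D" if x: "x \<in> Zring g" "0 \<le> x" "x < c" for x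
  proof -
    obtain t where "t \<in> S" "x < t" using x(3) less_cSup_iff[OF _ bdd] S1 unfolding c_def by blast
    then show ?thesis using x unfolding S_def by simp
  qed
  have "c = y"
  proof (rule ccontr)
    assume "c \<noteq> y"
    then have lt: "c < y" using cy by simp
    \<comment> \<open>A point \<open>Y\<close> of \<open>D\<close> just above \<open>c\<close> is
      built by moving from \<open>p < c\<close> towards \<open>y\<close> with ratio
      \<open>g ^ n\<close>. Closeness of \<open>p\<close> to \<open>c\<close> makes \<open>Y\<close>
      exceed \<open>c\<close>; smallness of \<open>g ^ n\<close> gives
      \<open>Y - p \<le> Y g\<close>, the condition under which \<open>extend\<close> fills
      everything up to \<open>Y\<close>.\<close>
    have "0 < c * g / y" using c1 g_pos lt by simp
    then obtain n where n: "g ^ n < c * g / y" using real_arch_pow_inv[OF _ g_less_1] by blast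
    have gn: "0 < g ^ n" using g_pos by simp
    have "0 < g ^ n * (y - c)" using gn lt by simp
    then obtain p where p: "p \<in> Zring g" "0 \<le> p" "p < c" "c - p < g ^ n * (y - c)"
      using Zring_g_dense[of c] c1 by force
    define Y where "Y = p + g ^ n * (y - p)"
    have YD: "Y \<in> D" unfolding Y_def
      using segment[OF full[OF p(1-3)] y Zring_g_power] gn g_power_le_1 by simp
    have "g ^ n * (y - c) \<le> g ^ n * (y - p)" using gn p(3) by simp
    then have Yc: "c < Y" unfolding Y_def using p(4) by linarith
    have "g ^ n * (y - p) \<le> 1 * (y - p)"
      by (rule mult_right_mono[OF g_power_le_1]) (use p lt in linarith)
    then have Yy: "Y \<le> y" unfolding Y_def by simp
    have "Y - p \<le> g ^ n * y" unfolding Y_def using gn p(2) by simp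
    also have "\<dots> \<le> c * g" using n lt c1 by (simp add: field_simps)
    also have "\<dots> \<le> Y * g" using Yc g_pos by simp
    finally have Yp: "Y - p \<le> Y * g" .
    have "x \<in> D" if "x \<in> Zring g" "0 \<le> x" "x \<le> Y" for x
      by (rule extend[OF _ YD _ Yp that]) (use full p Yc c1 in auto)
    then have "Y \<in> S" unfolding S_def using Yy by blast
    then have "Y \<le> c" unfolding c_def using cSup_upper bdd by blast
    then show False using Yc by simp
  qed
  then show ?thesis using full[OF z(1,2)] z(3) y by (cases "z = y") auto
qed

text \<open>The reflection \<open>x \<mapsto> 1 - x\<close> exchanges 0 and 1 and commutes with
  affine combinations, so \<open>fill_below\<close> applies to the reflected set.\<close>

lemma fill_above:
  assumes y: "y \<in> D" and z: "z \<in> Zring g" "z \<le> 0" "y \<le> z"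
  shows "z \<in> D"
proof -
  interpret reflected: convex_subset g m e "(\<lambda>x. 1 - x) ` D"
  proof
    show "(\<lambda>x. 1 - x) ` D \<subseteq> Zring g" using sub_Zring Zring_one Zring_diff by blast
    show "0 \<in> (\<lambda>x. 1 - x) ` D" using one_D by force
    show "1 \<in> (\<lambda>x. 1 - x) ` D" using zero_D by force
    fix k :: int assume k: "1 \<le> k" "k \<le> r"
    let ?s = "of_int k * g"
    show "s_convex ?s ((\<lambda>x. 1 - x) ` D)"
      unfolding s_convex_def
    proof clarify
      fix x y assume "x \<in> D" "y \<in> D"
      then have "?s * x + (1 - ?s) * y \<in> D" using convex_D[OF k] unfolding s_convex_def by blast
      moreover have "?s * (1 - x) + (1 - ?s) * (1 - y) = 1 - (?s * x + (1 - ?s) * y)"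
        by (simp add: algebra_simps)
      ultimately show "?s * (1 - x) + (1 - ?s) * (1 - y) \<in> (\<lambda>x. 1 - x) ` D" by blast
    qed
  qed
  have "1 - z \<in> (\<lambda>x. 1 - x) ` D"
    by (rule reflected.fill_below[of "1 - y"]) (use y z Zring_one Zring_diff in auto)
  then show ?thesis by force
qed

lemma order_convex:
  assumes "x \<in> D" "y \<in> D" "z \<in> Zring g" "x \<le> z" "z \<le> y"
  shows "z \<in> D"
  using fill_below[OF assms(2,3)] fill_above[OF assms(1,3)] assms(4,5) by linarith

end

section \<open>Conjugation\<close>

locale quadratic_Pisot =
  fixes m e :: int and \<beta> \<beta>' :: real
  assumes Pisot: "quadratic_unitary_Pisot m e \<beta> \<beta>'"
begin

lemma me: "e = 1 \<and> m \<ge> 1 \<or> e = -1 \<and> m \<ge> 4"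
  and square: "\<beta>\<^sup>2 = of_int m * \<beta> + of_int e"
  and square': "\<beta>'\<^sup>2 = of_int m * \<beta>' + of_int e"
  and less: "\<beta>' < \<beta>"
  and gt_1: "1 < \<beta>"
  using Pisot by (auto simp: quadratic_unitary_Pisot_def)

lemma conjugate_eq_diff: "\<beta>' = of_int m - \<beta>"
proof -
  have "(\<beta> - \<beta>') * (\<beta> + \<beta>') = (\<beta> - \<beta>') * of_int m"
    using square square' by (simp add: algebra_simps power2_eq_square)
  then show ?thesis using less by simp
qed

lemma conjugate_eq_inverse: "\<beta>' = - of_int e * (1 / \<beta>)"
proof -
  have "\<beta>' * \<beta> = - of_int e"
    using square unfolding conjugate_eq_diff by (simp add: algebra_simps power2_eq_square)
  then show ?thesis using gt_1 by (simp add: field_simps)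
qed

text \<open>Dividing the equation of \<open>\<beta>\<close> by \<open>\<beta>\<^sup>2\<close> gives
  \<open>1 = m g + e g\<^sup>2\<close> for \<open>g = 1 / \<beta>\<close>; multiplying by
  \<open>e\<close>, whose square is 1, yields the required form.\<close>

sublocale pisot_inverse "1 / \<beta>" m e
proof
  show "e = 1 \<and> m \<ge> 1 \<or> e = -1 \<and> m \<ge> 4" by (rule me)
  show "0 < 1 / \<beta>" "1 / \<beta> < 1" using gt_1 by auto
  have "of_int e * \<beta>\<^sup>2 = of_int e * of_int m * \<beta> + of_int (e * e)"
    unfolding square by (simp add: algebra_simps)
  moreover have "of_int (e * e) = (1::real)" using me by auto
  ultimately show "(1 / \<beta>)\<^sup>2 = of_int e * (1 - of_int m * (1 / \<beta>))"
    using gt_1 by (simp add: field_simps power2_eq_square)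
qed

lemma conjug: "conjug \<beta> \<beta>' (of_int a + of_int b * \<beta>) = of_int a + of_int b * \<beta>'"
  by (rule conjug_eq[OF Pisot])

lemma conjug_of_int: "conjug \<beta> \<beta>' (of_int a) = of_int a"
  using conjug[of a 0] by simp

lemma conjug_add:
  assumes "x \<in> Zring \<beta>" "y \<in> Zring \<beta>"
  shows "conjug \<beta> \<beta>' (x + y) = conjug \<beta> \<beta>' x + conjug \<beta> \<beta>' y"
proof -
  obtain a b c d :: int where xy: "x = of_int a + of_int b * \<beta>" "y = of_int c + of_int d * \<beta>"
    using assms unfolding Zring_iff by blast
  then have "x + y = of_int (a + c) + of_int (b + d) * \<beta>" by (simp add: algebra_simps)
  then show ?thesis by (simp only: xy conjug) (simp add: algebra_simps)
qed

lemma conjug_mult: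
  assumes "x \<in> Zring \<beta>" "y \<in> Zring \<beta>"
  shows "conjug \<beta> \<beta>' (x * y) = conjug \<beta> \<beta>' x * conjug \<beta> \<beta>' y"
proof -
  obtain a b c d :: int where xy: "x = of_int a + of_int b * \<beta>" "y = of_int c + of_int d * \<beta>"
    using assms unfolding Zring_iff by blast
  show ?thesis unfolding xy Zring_product[OF square] conjug Zring_product[OF square'] ..
qed

lemma conjug_uminus:
  assumes "x \<in> Zring \<beta>"
  shows "conjug \<beta> \<beta>' (- x) = - conjug \<beta> \<beta>' x"
  using conjug_mult[OF Zring_of_int[of "-1"] assms] conjug_of_int[of "-1"] by simp

lemma conjug_diff:
  assumes "x \<in> Zring \<beta>" "y \<in> Zring \<beta>"
  shows "conjug \<beta> \<beta>' (x - y) = conjug \<beta> \<beta>' x - conjug \<beta> \<beta>' y"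
  using conjug_add[OF assms(1) Zring_uminus[OF assms(2)]] conjug_uminus[OF assms(2)] by simp

lemma Zring_beta_mult: "x \<in> Zring \<beta> \<Longrightarrow> y \<in> Zring \<beta> \<Longrightarrow> x * y \<in> Zring \<beta>"
  by (rule Zring_mult[OF square])

lemma Zring_combination:
  assumes "s \<in> Zring \<beta>" "x \<in> Zring \<beta>" "y \<in> Zring \<beta>"
  shows "s * x + (1 - s) * y \<in> Zring \<beta>"
  using assms by (intro Zring_add Zring_beta_mult Zring_diff Zring_one)

lemma conjug_combination:
  assumes "s \<in> Zring \<beta>" "x \<in> Zring \<beta>" "y \<in> Zring \<beta>"
  shows "conjug \<beta> \<beta>' (s * x + (1 - s) * y)
    = conjug \<beta> \<beta>' s * conjug \<beta> \<beta>' x + (1 - conjug \<beta> \<beta>' s) * conjug \<beta> \<beta>' y"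
  using assms conjug_of_int[of 1]
  by (simp add: conjug_add conjug_mult conjug_diff Zring_beta_mult Zring_diff Zring_one)

text \<open>Because \<open>\<beta>' = - e / \<beta>\<close>, conjugation acts on coordinates by
  \<open>b \<mapsto> - b e\<close>, a bijection of the integers.\<close>

lemma conjug_image: "conjug \<beta> \<beta>' ` Zring \<beta> = Zring (1 / \<beta>)"
proof -
  have ee: "e * e = 1" using me by auto
  have eq: "of_int a + of_int b * \<beta>' = of_int a + of_int (- b * e) * (1 / \<beta>)" for a b
    unfolding conjugate_eq_inverse by simp
  have "of_int a + of_int b * (1 / \<beta>) = conjug \<beta> \<beta>' (of_int a + of_int (- b * e) * \<beta>)" for a b
    unfolding conjug eq using ee by (simp add: mult.assoc)
  then have "Zring (1 / \<beta>) \<subseteq> conjug \<beta> \<beta>' ` Zring \<beta>" unfolding Zring_def by blast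
  moreover have "conjug \<beta> \<beta>' ` Zring \<beta> \<subseteq> Zring (1 / \<beta>)"
    by (auto simp only: Zring_iff conjug eq) blast
  ultimately show ?thesis by blast
qed

text \<open>With \<open>\<beta>' = m - \<beta>\<close>, a vanishing conjugate means
  \<open>b \<beta> = a + b m\<close>; irrationality of \<open>\<beta>\<close> forces
  \<open>b = 0\<close> and then \<open>a = 0\<close>.\<close>

lemma inj_on_conjug: "inj_on (conjug \<beta> \<beta>') (Zring \<beta>)"
proof (rule inj_onI)
  fix x y assume xy: "x \<in> Zring \<beta>" "y \<in> Zring \<beta>" and eq: "conjug \<beta> \<beta>' x = conjug \<beta> \<beta>' y"
  obtain a b :: int where ab: "x - y = of_int a + of_int b * \<beta>"
    using Zring_diff[OF xy] unfolding Zring_iff by blast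
  have "of_int a + of_int b * \<beta>' = 0"
    using conjug_diff[OF xy] eq unfolding ab conjug by simp
  then have b\<beta>: "of_int b * \<beta> = of_int (a + b * m)"
    unfolding conjugate_eq_diff by (simp add: algebra_simps)
  have "b = 0"
  proof (rule ccontr)
    assume "b \<noteq> 0"
    then have "\<beta> = of_int (a + b * m) / of_int b"
      using b\<beta> by (simp add: field_simps)
    then have "\<beta> \<in> \<rat>" by (metis Rats_divide Rats_of_int)
    then show False using quadratic_unitary_Pisot_irrational[OF Pisot] by simp
  qed
  then show "x = y" using b\<beta> ab by simp
qed

text \<open>The witness is the power \<open>\<beta>' ^ n\<close>: these elements shrink to 0 while
  their conjugates grow without bound.\<close>

lemma power_preimage: "\<exists>w \<in> Zring \<beta>. conjug \<beta> \<beta>' w = \<beta> ^ n \<and> \<bar>w\<bar> = (1 / \<beta>) ^ n"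
proof (induction n)
  case 0
  show ?case using conjug_of_int[of 1] Zring_one by (intro bexI[of _ 1]) auto
next
  case (Suc n)
  then obtain w where w: "w \<in> Zring \<beta>" "conjug \<beta> \<beta>' w = \<beta> ^ n" "\<bar>w\<bar> = (1 / \<beta>) ^ n" by blast
  have beta': "\<beta>' = of_int m + of_int (-1) * \<beta>" by (simp add: conjugate_eq_diff)
  have "\<beta>' \<in> Zring \<beta>" using beta' unfolding Zring_iff by blast
  moreover have "conjug \<beta> \<beta>' \<beta>' = \<beta>"
    using conjug[of m "-1"] by (simp add: conjugate_eq_diff)
  moreover have "\<bar>\<beta>'\<bar> = 1 / \<beta>" using me gt_1 by (auto simp: conjugate_eq_inverse)
  ultimately show ?case using w
    by (intro bexI[of _ "\<beta>' * w"]) (simp_all add: conjug_mult Zring_beta_mult abs_mult)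
qed

section \<open>The two implications of the equivalence\<close>

lemma model_set_s_convex:
  assumes "model_set \<beta> \<beta>' \<Lambda>" "s \<in> N_set m e \<beta> \<beta>'"
  shows "s_convex s \<Lambda>"
  unfolding s_convex_def
proof (intro ballI)
  obtain \<Omega> where \<Omega>: "is_interval \<Omega>" and \<Lambda>: "\<Lambda> = Sigma_set \<beta> \<beta>' \<Omega>"
    using assms(1) unfolding model_set_def by blast
  obtain k :: int where s: "s \<in> Zring \<beta>" and k: "conjug \<beta> \<beta>' s = of_int k / \<beta>" "1 \<le> k" "k \<le> r"
    using assms(2) unfolding N_set_def by blast
  \<comment> \<open>Convexity of \<open>\<Omega>\<close> needs the ratio \<open>k / \<beta>\<close>
    to be at most 1. From \<open>\<bar>\<beta>'\<bar> < 1\<close> follows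
    \<open>\<beta> > m - 1\<close>, which suffices except for \<open>m = 1\<close>, where
    \<open>k = 1\<close>.\<close>
  have "of_int k \<le> \<beta>"
  proof -
    have "\<bar>\<beta>'\<bar> < 1" using me gt_1 by (auto simp: conjugate_eq_inverse)
    then have "of_int m - 1 < \<beta>" by (simp add: conjugate_eq_diff abs_less_iff)
    moreover have "k \<le> 1 \<or> k \<le> m - 1" using k(3) me by (auto simp: r_index_eq)
    ultimately show ?thesis using gt_1 by fastforce
  qed
  then have c: "0 \<le> conjug \<beta> \<beta>' s" "conjug \<beta> \<beta>' s \<le> 1" using k gt_1 by auto
  fix x y assume "x \<in> \<Lambda>" "y \<in> \<Lambda>"
  then have xy: "x \<in> Zring \<beta>" "y \<in> Zring \<beta>" "conjug \<beta> \<beta>' x \<in> \<Omega>" "conjug \<beta> \<beta>' y \<in> \<Omega>"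
    unfolding \<Lambda> Sigma_set_def by auto
  have "conjug \<beta> \<beta>' s * conjug \<beta> \<beta>' x + (1 - conjug \<beta> \<beta>' s) * conjug \<beta> \<beta>' y \<in> \<Omega>"
    using convexD[OF is_interval_convex[OF \<Omega>] xy(3,4), of "conjug \<beta> \<beta>' s"] c by simp
  then show "s * x + (1 - s) * y \<in> \<Lambda>"
    using Zring_combination[OF s xy(1,2)] conjug_combination[OF s xy(1,2)]
    unfolding \<Lambda> Sigma_set_def by simp
qed

lemma s_convex_model_set:
  assumes sub: "\<Lambda> \<subseteq> Zring \<beta>" and discrete: "uniform_discrete \<Lambda>"
    and zero: "0 \<in> \<Lambda>" and one: "1 \<in> \<Lambda>"
    and conv: "\<And>s. s \<in> N_set m e \<beta> \<beta>' \<Longrightarrow> s_convex s \<Lambda>"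
  shows "model_set \<beta> \<beta>' \<Lambda>"
proof -
  define D where "D = conjug \<beta> \<beta>' ` \<Lambda>"
  interpret convex_subset "1 / \<beta>" m e D
  proof
    show "D \<subseteq> Zring (1 / \<beta>)" unfolding D_def using conjug_image sub by blast
    show "0 \<in> D" unfolding D_def using zero conjug_of_int[of 0] by force
    show "1 \<in> D" unfolding D_def using one conjug_of_int[of 1] by force
    fix k :: int assume k: "1 \<le> k" "k \<le> r"
    \<comment> \<open>This is the element with conjugate \<open>k / \<beta>\<close>:
      \<open>- e k \<beta>' = e\<^sup>2 k / \<beta>\<close>.\<close>
    define s where "s = of_int (- e * k) * \<beta>"
    have s: "s \<in> Zring \<beta>" unfolding s_def by (intro Zring_beta_mult Zring_of_int Zring_self)
    have "of_int e * of_int e = (1::real)" using me by auto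
    then have cs: "conjug \<beta> \<beta>' s = of_int k * (1 / \<beta>)"
      using conjug[of 0 "- e * k"] unfolding s_def conjugate_eq_inverse by simp
    then have "s \<in> N_set m e \<beta> \<beta>'" unfolding N_set_def using s k by auto
    then have "s_convex s \<Lambda>" by (rule conv)
    then show "s_convex (of_int k * (1 / \<beta>)) D"
      unfolding s_convex_def D_def cs[symmetric]
    proof clarify
      fix x y assume xy: "x \<in> \<Lambda>" "y \<in> \<Lambda>"
      then have "s * x + (1 - s) * y \<in> \<Lambda>" using \<open>s_convex s \<Lambda>\<close> unfolding s_convex_def by blast
      then show "conjug \<beta> \<beta>' s * conjug \<beta> \<beta>' x + (1 - conjug \<beta> \<beta>' s) * conjug \<beta> \<beta>' y
          \<in> conjug \<beta> \<beta>' ` \<Lambda>"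
        using conjug_combination[OF s] xy sub by (metis image_eqI subsetD)
    qed
  qed
  have mem: "x \<in> \<Lambda>" if "x \<in> Zring \<beta>" "conjug \<beta> \<beta>' x \<in> D" for x
    using inj_on_image_mem_iff[OF inj_on_conjug that(1) sub] that(2) unfolding D_def by blast
  have mem_ring: "conjug \<beta> \<beta>' x \<in> Zring (1 / \<beta>)" if "x \<in> Zring \<beta>" for x
    using conjug_image that by blast
  obtain \<epsilon> where \<epsilon>: "\<epsilon> > 0" "\<And>x y. \<lbrakk>x \<in> \<Lambda>; y \<in> \<Lambda>; dist x y < \<epsilon>\<rbrakk> \<Longrightarrow> x = y"
    using discrete unfolding uniform_discrete_def by blast
  \<comment> \<open>For this \<open>n\<close> both \<open>w\<close> and \<open>- w\<close> are
    nonzero and too close to \<open>0 \<in> \<Lambda>\<close> to belong to \<open>\<Lambda>\<close>.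
    Their conjugates \<open>\<beta> ^ n\<close> and \<open>- (\<beta> ^ n)\<close> are thus missing
    from \<open>D\<close> and bound it by order convexity.\<close>
  obtain n where n: "(1 / \<beta>) ^ n < \<epsilon>" using real_arch_pow_inv[OF \<epsilon>(1) g_less_1] by blast
  obtain w where w: "w \<in> Zring \<beta>" "conjug \<beta> \<beta>' w = \<beta> ^ n" "\<bar>w\<bar> = (1 / \<beta>) ^ n"
    using power_preimage by blast
  have w0: "w \<noteq> 0" using w(3) g_pos by auto
  have notin: "w \<notin> \<Lambda>" "- w \<notin> \<Lambda>"
    using \<epsilon>(2)[OF zero, of w] \<epsilon>(2)[OF zero, of "- w"] w(3) n w0 by (auto simp: dist_real_def)
  have mw: "- w \<in> Zring \<beta>" "conjug \<beta> \<beta>' (- w) = - (\<beta> ^ n)"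
    using w Zring_uminus conjug_uminus by auto
  have pos: "0 < \<beta> ^ n" using gt_1 by simp
  have bound: "\<bar>y\<bar> < \<beta> ^ n" if y: "y \<in> D" for y
  proof (rule ccontr)
    assume "\<not> \<bar>y\<bar> < \<beta> ^ n"
    then consider "\<beta> ^ n \<le> y" | "y \<le> - (\<beta> ^ n)" by linarith
    then show False
    proof cases
      case 1
      then have "\<beta> ^ n \<in> D"
        using order_convex[OF zero_D y, of "\<beta> ^ n"] mem_ring[OF w(1)] w(2) pos by simp
      then show False using mem w notin by simp
    next
      case 2
      then have "- (\<beta> ^ n) \<in> D"
        using order_convex[OF y zero_D, of "- (\<beta> ^ n)"] mem_ring[OF mw(1)] mw(2) pos by simp
      then show False using mem mw notin by simp
    qed
  qed
  \<comment> \<open>Taking the order-convex hull of \<open>D\<close> as the window includes each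
    endpoint exactly when \<open>D\<close> attains it, so no case distinction on endpoints
    arises.\<close>
  define \<Omega> where "\<Omega> = {z. \<exists>x\<in>D. \<exists>y\<in>D. x \<le> z \<and> z \<le> y}"
  have "is_interval \<Omega>" unfolding is_interval_1 \<Omega>_def by (blast intro: order_trans)
  moreover have "bounded \<Omega>"
  proof (rule bounded_subset[OF bounded_closed_interval])
    show "\<Omega> \<subseteq> {- (\<beta> ^ n)..\<beta> ^ n}" unfolding \<Omega>_def using bound by (force simp: abs_less_iff)
  qed
  moreover have "\<Lambda> = Sigma_set \<beta> \<beta>' \<Omega>"
  proof
    show "\<Lambda> \<subseteq> Sigma_set \<beta> \<beta>' \<Omega>" unfolding Sigma_set_def \<Omega>_def D_def using sub by auto
    show "Sigma_set \<beta> \<beta>' \<Omega> \<subseteq> \<Lambda>"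
      unfolding Sigma_set_def \<Omega>_def using order_convex mem mem_ring by blast
  qed
  ultimately show ?thesis unfolding model_set_def by blast
qed

end

theorem theorem4p2:
  fixes m e :: int and \<beta> \<beta>' :: real and \<Lambda> :: "real set"
  assumes "quadratic_unitary_Pisot m e \<beta> \<beta>'"
    and "\<Lambda> \<subseteq> Zring \<beta>"
    and "uniform_discrete \<Lambda>"
    and "0 \<in> \<Lambda>" and "1 \<in> \<Lambda>"
  shows "model_set \<beta> \<beta>' \<Lambda> \<longleftrightarrow> (\<forall>s \<in> N_set m e \<beta> \<beta>'. s_convex s \<Lambda>)"
proof -
  interpret quadratic_Pisot m e \<beta> \<beta>' by unfold_locales (rule assms(1))
  show ?thesis using model_set_s_convex s_convex_model_set[OF assms(2-5)] by blast
qed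

end
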